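(* Let $n,m\ge 2$ and $k\ge 2$. If $G\le S_m$ and $H\le S_n$ are both $k$-representable, then the direct sum $G\oplus H\le S_{n+m}$ is $r$-representable for every $r$ satisfying $r^2\ge k$.
   Context: A group $G\le S_n$ acts on $\{0,1\}^n$ by $x^\sigma=(x_{\sigma(1)},\ldots,x_{\sigma(n)})$. For $k\ge 2$, a $k$-valued boolean function is a map $f:\{0,1\}^n\to\{0,1,\ldots,k-1\}$, and its symmetry group is $S(f)=\{\sigma\in S_n: f(x^\sigma)=f(x)\text{ for all }x\}$. A permutation group $G\le S_n$ is $k$-representable if $G=S(f)$ for some $k$-valued boolean function $f$ on $\{0,1\}^n$. For $G\le S_m$, $H\le S_n$, the direct sum $G\oplus H$ is the group of permutations $(\sigma,\tau)$ of $\{1,\ldots,m+n\}$ acting as $\sigma\in G$ on $\{1,\ldots,m\}$ and as $\tau\in H$ (shifted by $m$) on $\{m+1,\ldots,m+n\}$. *)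

theory Defs
  imports "HOL-Algebra.Sym_Groups"
begin

text \<open>
  The index set is \<open>{1..n}\<close>, as in \<^const>\<open>sym_group\<close>.  A point \<open>x\<close> of the cube is a function
  that is \<open>undefined\<close> outside \<open>{1..n}\<close>; a permutation in \<open>sym_group n\<close> fixes every number
  outside \<open>{1..n}\<close>, so \<open>x \<circ> \<sigma>\<close> is again a point of the cube, namely
  \<open>(x (\<sigma> 1), \<dots>, x (\<sigma> n))\<close>.
\<close>

definition cube :: "nat \<Rightarrow> (nat \<Rightarrow> nat) set" where
  "cube n = {1..n} \<rightarrow>\<^sub>E {0, 1}"

definition valued_boolean_function :: "nat \<Rightarrow> nat \<Rightarrow> ((nat \<Rightarrow> nat) \<Rightarrow> nat) \<Rightarrow> bool" where
  "valued_boolean_function k n f \<longleftrightarrow> 2 \<le> k \<and> f \<in> cube n \<rightarrow> {0..<k}"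

definition symmetry_group :: "nat \<Rightarrow> ((nat \<Rightarrow> nat) \<Rightarrow> nat) \<Rightarrow> (nat \<Rightarrow> nat) set" where
  "symmetry_group n f = {\<sigma> \<in> carrier (sym_group n). \<forall>x \<in> cube n. f (x \<circ> \<sigma>) = f x}"

definition representable :: "nat \<Rightarrow> nat \<Rightarrow> (nat \<Rightarrow> nat) set \<Rightarrow> bool" where
  "representable k n G \<longleftrightarrow>
     subgroup G (sym_group n) \<and>
     (\<exists>f. valued_boolean_function k n f \<and> G = symmetry_group n f)"

definition sum_perm :: "nat \<Rightarrow> nat \<Rightarrow> (nat \<Rightarrow> nat) \<Rightarrow> (nat \<Rightarrow> nat) \<Rightarrow> nat \<Rightarrow> nat" where
  "sum_perm m n \<sigma> \<tau> i =
     (if i \<in> {1..m} then \<sigma> i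
      else if i \<in> {m+1..m+n} then m + \<tau> (i - m)
      else i)"

definition direct_sum :: "nat \<Rightarrow> nat \<Rightarrow> (nat \<Rightarrow> nat) set \<Rightarrow> (nat \<Rightarrow> nat) set \<Rightarrow> (nat \<Rightarrow> nat) set" where
  "direct_sum m n G H = {sum_perm m n \<sigma> \<tau> | \<sigma> \<tau>. \<sigma> \<in> G \<and> \<tau> \<in> H}"

end

theory Submission
  imports Defs "HOL-Library.Indicator_Function"
begin

text \<open>
  Identify points of the cube with subsets of the index set.  Written in base \<open>r\<close>, a function with
  at most \<open>r\<^sup>2\<close> values is a pair \<open>(a, b)\<close> of \<open>r\<close>-valued functions with the same joint symmetries;
  let \<open>(a, b)\<close> and \<open>(c, d)\<close> be such pairs for \<open>G\<close> on the block \<open>A\<close> and for \<open>H\<close> on the block \<open>B\<close>.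
  Their values at the empty set and at the full block do not affect the symmetries, so one function
  \<open>F\<close> on \<open>A \<union> B\<close> can carry all four: \<open>F(X) = a(X)\<close>, \<open>F(X \<union> B) = b(X)\<close>, \<open>F(Y) = c(Y)\<close>,
  \<open>F(A \<union> Y) = d(Y)\<close> for proper nonempty \<open>X\<close>, \<open>Y\<close>, and \<open>F(X \<union> Y) = 0\<close>.
  It remains to force symmetries of \<open>F\<close> to preserve the blocks.  As a graph or its complement is
  connected, exchanging the digits 0 and 1 if necessary makes the graph of pairs with nonzero value
  connected on each block.  No such pair joins \<open>A\<close> to \<open>B\<close>, so the blocks are the components of the
  graph, and they cannot be exchanged if their sizes differ; here \<open>F(A) = F(B) = 1\<close>, as a block with
  two elements is itself a pair.  If the sizes agree, put \<open>F(A) = 1\<close> and \<open>F(B) = 0\<close>: then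
  \<open>A\<close> is the only set of its size where \<open>F\<close> is not 0.
\<close>

section \<open>Symmetries of set functions, pair graphs, and gluing\<close>

definition set_symmetries :: "'a set \<Rightarrow> ('a set \<Rightarrow> 'b) \<Rightarrow> ('a \<Rightarrow> 'a) set" where
  "set_symmetries A \<phi> = {\<sigma>. \<sigma> permutes A \<and> (\<forall>S\<subseteq>A. \<phi> (\<sigma> ` S) = \<phi> S)}"

text \<open>Connectedness, stated by cuts, of the graph whose edges are the pairs with nonzero
  value.\<close>

definition pair_connected :: "'a set \<Rightarrow> ('a set \<Rightarrow> nat) \<Rightarrow> bool" where
  "pair_connected A \<phi> \<longleftrightarrow> (\<forall>S. S \<noteq> {} \<and> S \<subset> A \<longrightarrow> (\<exists>x\<in>S. \<exists>y\<in>A - S. \<phi> {x, y} \<noteq> 0))"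

text \<open>The order of the cases matters: the empty set, the whole set and the single blocks come
  first, so \<open>a\<close>, \<open>b\<close>, \<open>c\<close>, \<open>d\<close> are read only at
  proper nonempty subsets of their blocks.\<close>

definition glue :: "'a set \<Rightarrow> 'a set \<Rightarrow> ('a set \<Rightarrow> nat) \<Rightarrow> ('a set \<Rightarrow> nat) \<Rightarrow>
    ('a set \<Rightarrow> nat) \<Rightarrow> ('a set \<Rightarrow> nat) \<Rightarrow> 'a set \<Rightarrow> nat" where
  "glue A B a b c d S =
    (let X = S \<inter> A; Y = S \<inter> B in
     if X = {} \<and> Y = {} \<or> X = A \<and> Y = B then 0
     else if X = A \<and> Y = {} then 1
     else if X = {} \<and> Y = B then (if card A = card B then 0 else 1)
     else if Y = {} then a X
     else if Y = B then b X
     else if X = {} then c Y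
     else if X = A then d Y
     else 0)"

section \<open>Two digits, the first with a connected pair graph\<close>

lemma pair_connectedE:
  assumes "pair_connected A \<phi>" "S \<noteq> {}" "S \<subset> A"
  obtains x y where "x \<in> S" "y \<in> A - S" "\<phi> {x, y} \<noteq> 0"
  using assms unfolding pair_connected_def by metis

text \<open>Otherwise some cut \<open>S\<close> is crossed only by zero pairs and some cut
  \<open>T\<close> only by nonzero ones. No pair crosses both, so in the two-by-two table of the
  cuts each diagonal has an empty cell. These two cells fill a row or a column, so a side of one cut
  is empty.\<close>

lemma pair_connected_or_complement:
  "pair_connected A \<phi> \<or> pair_connected A (\<lambda>S. if \<phi> S = 0 then 1 else 0)"
proof (rule ccontr)
  assume "\<not> ?thesis"
  then obtain S T where S: "S \<noteq> {}" "S \<subset> A" "\<And>x y. x \<in> S \<Longrightarrow> y \<in> A - S \<Longrightarrow> \<phi> {x, y} = 0"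
    and T: "T \<noteq> {}" "T \<subset> A" "\<And>x y. x \<in> T \<Longrightarrow> y \<in> A - T \<Longrightarrow> \<phi> {x, y} \<noteq> 0"
    unfolding pair_connected_def by (auto split: if_splits)
  have "S \<inter> T = {} \<or> (A - S) \<inter> (A - T) = {}"
  proof (rule ccontr)
    assume "\<not> ?thesis"
    then obtain x y where "x \<in> S" "x \<in> T" "y \<in> A - S" "y \<in> A - T"
      by blast
    then show False
      using S(3)[of x y] T(3)[of x y] by simp
  qed
  moreover have "S \<inter> (A - T) = {} \<or> (A - S) \<inter> T = {}"
  proof (rule ccontr)
    assume "\<not> ?thesis"
    then obtain x y where "x \<in> S" "x \<in> A - T" "y \<in> A - S" "y \<in> T"
      by blast
    then show False
      using S(3)[of x y] T(3)[of y x] by (simp add: insert_commute)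
  qed
  ultimately show False
    using S(1,2) T(1,2) by blast
qed

text \<open>The quotient and remainder by \<open>r\<close> determine \<open>\<phi>\<close>, and the
  quotient is below \<open>r\<close> because \<open>\<phi>\<close> is below
  \<open>r\<^sup>2\<close>. Exchanging two digit values is injective, so the symmetries stay the
  same.\<close>

lemma digits_pair_connected:
  fixes \<phi> :: "'a set \<Rightarrow> nat"
  assumes bound: "\<And>S. S \<subseteq> A \<Longrightarrow> \<phi> S < k" and "k \<le> r\<^sup>2" and r: "2 \<le> r"
  obtains a b where "\<forall>S\<subseteq>A. a S < r \<and> b S < r" "pair_connected A a"
    "set_symmetries A \<phi> = set_symmetries A (\<lambda>S. (a S, b S))"
proof -
  let ?a = "\<lambda>S. \<phi> S div r" and ?b = "\<lambda>S. \<phi> S mod r"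
  define swap where "swap = (\<lambda>i::nat. if i = 0 then 1 else if i = 1 then 0 else i)"
  have swap_eq: "swap i = swap j \<longleftrightarrow> i = j" for i j
    by (auto simp: swap_def)
  have swap_less: "i < r \<Longrightarrow> swap i < r" for i
    using r by (auto simp: swap_def)
  have a: "?a S < r" if "S \<subseteq> A" for S
    using bound[OF that] assms(2) by (simp add: less_mult_imp_div_less power2_eq_square)
  have b: "?b S < r" for S
    using r by simp
  have digits: "?a S = ?a T \<and> ?b S = ?b T \<longleftrightarrow> \<phi> S = \<phi> T" for S T
    by (metis div_mult_mod_eq)
  consider "pair_connected A ?a" | "pair_connected A (\<lambda>S. swap (?a S))"
  proof -
    assume *: "pair_connected A ?a \<Longrightarrow> thesis" "pair_connected A (\<lambda>S. swap (?a S)) \<Longrightarrow> thesis"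
    \<comment> \<open>\<open>swap\<close> sends 0 to 1, so the new graph contains the complement of
      the old one.\<close>
    have "pair_connected A (\<lambda>S. if ?a S = 0 then 1 else 0) \<Longrightarrow> pair_connected A (\<lambda>S. swap (?a S))"
      unfolding pair_connected_def swap_def by (metis (no_types, lifting) zero_neq_one)
    with * show thesis
      using pair_connected_or_complement[of A ?a] by blast
  qed
  then show thesis
  proof cases
    case 1
    then show thesis
      using that[of ?a ?b] a b digits by (simp add: set_symmetries_def)
  next
    case 2
    then show thesis
      using that[of "\<lambda>S. swap (?a S)" ?b] a b digits swap_less
      by (simp add: set_symmetries_def swap_eq)
  qed
qed

section \<open>Symmetries of the glued function\<close>

lemma glue_less:
  assumes "2 \<le> r" "\<And>S. S \<subseteq> A \<Longrightarrow> a S < r \<and> b S < r" "\<And>S. S \<subseteq> B \<Longrightarrow> c S < r \<and> d S < r"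
  shows "glue A B a b c d S < r"
  using assms by (auto simp: glue_def Let_def)

lemma glue_symmetry_preserves_block:
  fixes A B :: "'a set"
  assumes fin: "finite A" "finite B" and disj: "A \<inter> B = {}"
    and card: "2 \<le> card A" "2 \<le> card B"
    and conn: "pair_connected A a" "pair_connected B c"
    and \<sigma>: "\<sigma> \<in> set_symmetries (A \<union> B) (glue A B a b c d)"
  shows "\<sigma> ` A = A"
proof -
  let ?F = "glue A B a b c d"
  have perm: "\<sigma> permutes A \<union> B" and inv: "\<And>S. S \<subseteq> A \<union> B \<Longrightarrow> ?F (\<sigma> ` S) = ?F S"
    using \<sigma> by (auto simp: set_symmetries_def)
  have ne: "A \<noteq> {}" "B \<noteq> {}" using card by auto
  define C where "C = \<sigma> ` A"
  have img: "\<sigma> ` (A \<union> B) = A \<union> B"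
    using perm by (rule permutes_image)
  have "C \<subseteq> \<sigma> ` (A \<union> B)"
    unfolding C_def by (rule image_mono) simp
  moreover have "card C = card A"
    unfolding C_def by (rule card_image) (rule inj_on_subset[OF permutes_inj[OF perm] subset_UNIV])
  ultimately have C: "C \<subseteq> A \<union> B" "card C = card A" "finite C" "C \<noteq> {}"
    using fin ne by (simp_all add: C_def img)
  \<comment> \<open>Pulled back along \<open>\<sigma>\<close>, the pair has one point in each block.
    Neither point fills its block, so \<open>glue\<close> reaches its last case.\<close>
  have cut: "?F {x, y} = 0" if xy: "x \<in> C" "y \<in> (A \<union> B) - C" for x y
  proof -
    obtain x' where x': "x' \<in> A" "x = \<sigma> x'"
      using xy(1) by (auto simp: C_def)
    have "y \<in> \<sigma> ` (A \<union> B)"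
      using xy(2) by (simp add: img)
    then obtain y' where y': "y' \<in> A \<union> B" "y = \<sigma> y'"
      by (rule imageE) simp
    then have "y' \<in> B"
      using xy(2) by (auto simp: C_def)
    note x'y' = x'(1) this x'(2) y'(2)
    have "{x', y'} \<inter> A = {x'}" "{x', y'} \<inter> B = {y'}"
      using x'y' disj by auto
    moreover have "{x'} \<noteq> A" "{y'} \<noteq> B"
      using card by auto
    ultimately have "?F {x', y'} = 0"
      by (simp add: glue_def)
    then show ?thesis
      using inv[of "{x', y'}"] x'y' by simp
  qed
  show ?thesis
  proof (cases "card A = card B")
    case True
    have "?F A \<noteq> 0"
      using disj ne by (auto simp: glue_def Let_def Int_absorb)
    then have "?F C \<noteq> 0"
      using inv[of A] by (simp add: C_def)
    \<comment> \<open>Equal sizes turn inclusions into equalities. Hence a \<open>C\<close> meeting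
      both blocks contains neither and has value 0, as does \<open>B\<close>; only \<open>A\<close>
      remains.\<close>
    moreover have "C \<subseteq> A \<Longrightarrow> C = A" "C \<subseteq> B \<Longrightarrow> C = B" "A \<subseteq> C \<Longrightarrow> A = C" "B \<subseteq> C \<Longrightarrow> B = C"
      using C(2,3) True fin by (simp_all add: card_subset_eq)
    moreover have "C \<inter> A = {} \<Longrightarrow> C \<subseteq> B" "C \<inter> B = {} \<Longrightarrow> C \<subseteq> A"
      using C(1) by auto
    ultimately have "C = A"
      using disj ne True
      by (auto simp: glue_def Let_def Int_absorb split: if_splits)
    then show ?thesis
      by (simp add: C_def)
  next
    case False
    \<comment> \<open>If \<open>{x, y}\<close> is all of \<open>A\<close>, the value is 1 instead of
      \<open>a {x, y}\<close>, still nonzero.\<close>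
    have pairA: "?F {x, y} \<noteq> 0" if "x \<in> A" "y \<in> A" "a {x, y} \<noteq> 0" for x y
    proof -
      have "{x, y} \<inter> A = {x, y}" "{x, y} \<inter> B = {}"
        using that disj by auto
      then show ?thesis
        using that ne by (auto simp: glue_def Let_def)
    qed
    \<comment> \<open>If \<open>{x, y}\<close> is all of \<open>B\<close>, the value is 1 because
      the sizes differ.\<close>
    have pairB: "?F {x, y} \<noteq> 0" if "x \<in> B" "y \<in> B" "c {x, y} \<noteq> 0" for x y
    proof -
      have "{x, y} \<inter> A = {}" "{x, y} \<inter> B = {x, y}"
        using that disj by auto
      then show ?thesis
        using that ne False by (auto simp: glue_def Let_def)
    qed
    \<comment> \<open>An edge within \<open>A\<close> leaving \<open>C \<inter> A\<close> would
      contradict \<open>cut\<close>, so \<open>C\<close> contains \<open>A\<close> or misses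
      it.\<close>
    have "\<not> C \<inter> A \<subset> A" if "C \<inter> A \<noteq> {}"
    proof
      assume "C \<inter> A \<subset> A"
      with that obtain x y where "x \<in> C \<inter> A" "y \<in> A - C \<inter> A" "a {x, y} \<noteq> 0"
        by (rule pair_connectedE[OF conn(1)])
      then show False
        using pairA[of x y] cut[of x y] by auto
    qed
    \<comment> \<open>Such a \<open>C\<close> would be a proper subset of \<open>B\<close> by size,
      and an edge within \<open>B\<close> would leave it, against \<open>cut\<close>.\<close>
    moreover have "\<not> C \<subseteq> B"
    proof
      assume "C \<subseteq> B"
      then have "C \<subset> B"
        using C False by auto
      then obtain x y where "x \<in> C" "y \<in> B - C" "c {x, y} \<noteq> 0"
        by (rule pair_connectedE[OF conn(2) C(4)])
      then show False
        using pairB[of x y] cut[of x y] \<open>C \<subset> B\<close> by auto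
    qed
    ultimately have "A \<subseteq> C"
      using C(1) by blast
    then show ?thesis
      using C card_subset_eq[of C A] by (simp add: C_def)
  qed
qed

text \<open>A permutation fixing \<open>A\<close> also fixes \<open>B\<close>. The values at subsets
  of one block, alone or joined with the whole other block, then give back the four
  functions.\<close>

lemma set_symmetries_glue:
  fixes A B :: "'a set"
  assumes fin: "finite A" "finite B" and disj: "A \<inter> B = {}"
    and card: "2 \<le> card A" "2 \<le> card B"
    and conn: "pair_connected A a" "pair_connected B c"
  shows "set_symmetries (A \<union> B) (glue A B a b c d) =
    {\<sigma>. \<sigma> permutes A \<union> B \<and> \<sigma> ` A = A \<and>
      (\<forall>S\<subseteq>A. a (\<sigma> ` S) = a S \<and> b (\<sigma> ` S) = b S) \<and>
      (\<forall>S\<subseteq>B. c (\<sigma> ` S) = c S \<and> d (\<sigma> ` S) = d S)}" (is "?L = ?R")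
proof -
  let ?F = "glue A B a b c d"
  have ne: "A \<noteq> {}" "B \<noteq> {}" using card by auto
  have imgB: "\<sigma> ` B = B" if "\<sigma> permutes A \<union> B" "\<sigma> ` A = A" for \<sigma>
  proof -
    have "\<sigma> ` (A \<union> B - A) = A \<union> B - A"
      using that by (simp add: image_set_diff permutes_inj permutes_image)
    then show ?thesis using disj by (simp add: Un_Diff Diff_triv Int_commute)
  qed
  have LR: "\<sigma> \<in> ?R" if \<sigma>: "\<sigma> \<in> ?L" for \<sigma>
  proof -
    have perm: "\<sigma> permutes A \<union> B" and inv: "\<And>S. S \<subseteq> A \<union> B \<Longrightarrow> ?F (\<sigma> ` S) = ?F S"
      using \<sigma> by (auto simp: set_symmetries_def)
    have A: "\<sigma> ` A = A"
      using glue_symmetry_preserves_block[OF assms \<sigma>] .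
    note B = imgB[OF perm A]
    have "a (\<sigma> ` S) = a S \<and> b (\<sigma> ` S) = b S" if "S \<subseteq> A" for S
    \<comment> \<open>\<open>glue\<close> does not record \<open>a\<close> and \<open>b\<close> at
      these two sets, but \<open>\<sigma>\<close> maps each of them to itself.\<close>
    proof (cases "S = {} \<or> S = A")
      case False
      have "\<sigma> ` S \<subseteq> A" "\<sigma> ` S \<noteq> {}" "\<sigma> ` S \<noteq> A"
        using False that A permutes_inj[OF perm] by (auto simp: inj_image_eq_iff dest: inj_image_mem_iff)
      moreover have "?F T = a T" "?F (T \<union> B) = b T" if "T \<subseteq> A" "T \<noteq> {}" "T \<noteq> A" for T
      proof -
        have "T \<inter> A = T" "T \<inter> B = {}" "(T \<union> B) \<inter> A = T" "(T \<union> B) \<inter> B = B"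
          using that disj by auto
        then show "?F T = a T" "?F (T \<union> B) = b T"
          using that ne by (simp_all add: glue_def)
      qed
      ultimately show ?thesis
        using inv[of S] inv[of "S \<union> B"] that False B by (auto simp: image_Un)
    qed (auto simp: A)
    moreover have "c (\<sigma> ` S) = c S \<and> d (\<sigma> ` S) = d S" if "S \<subseteq> B" for S
    proof (cases "S = {} \<or> S = B")
      case False
      have "\<sigma> ` S \<subseteq> B" "\<sigma> ` S \<noteq> {}" "\<sigma> ` S \<noteq> B"
        using False that B permutes_inj[OF perm] by (auto simp: inj_image_eq_iff dest: inj_image_mem_iff)
      moreover have "?F T = c T" "?F (T \<union> A) = d T" if "T \<subseteq> B" "T \<noteq> {}" "T \<noteq> B" for T
      proof -
        have "T \<inter> B = T" "T \<inter> A = {}" "(T \<union> A) \<inter> B = T" "(T \<union> A) \<inter> A = A"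
          using that disj by auto
        then show "?F T = c T" "?F (T \<union> A) = d T"
          using that ne by (simp_all add: glue_def)
      qed
      ultimately show ?thesis
        using inv[of S] inv[of "S \<union> A"] that False A by (auto simp: image_Un)
    qed (auto simp: B)
    ultimately show ?thesis
      using perm A by blast
  qed
  have RL: "\<sigma> \<in> ?L" if "\<sigma> \<in> ?R" for \<sigma>
  proof -
    have perm: "\<sigma> permutes A \<union> B" and A: "\<sigma> ` A = A"
      and inv: "\<And>S. S \<subseteq> A \<Longrightarrow> a (\<sigma> ` S) = a S \<and> b (\<sigma> ` S) = b S"
        "\<And>S. S \<subseteq> B \<Longrightarrow> c (\<sigma> ` S) = c S \<and> d (\<sigma> ` S) = d S"
      using that by auto
    note B = imgB[OF perm A] and inj = permutes_inj[OF perm]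
    \<comment> \<open>By injectivity, intersecting with a block commutes with
      \<open>\<sigma>\<close>, so every case test in \<open>glue\<close> is invariant.\<close>
    have *: "\<sigma> ` S \<inter> A = \<sigma> ` (S \<inter> A)" "\<sigma> ` S \<inter> B = \<sigma> ` (S \<inter> B)" for S
      using A B image_Int[OF inj] by metis+
    have **: "\<sigma> ` S = A \<longleftrightarrow> S = A" "\<sigma> ` S = B \<longleftrightarrow> S = B" for S
      using A B inj_image_eq_iff[OF inj] by metis+
    have "?F (\<sigma> ` S) = ?F S" for S
      by (simp add: glue_def Let_def * ** inv)
    then show ?thesis
      using perm by (simp add: set_symmetries_def)
  qed
  show ?thesis
    by (intro equalityI subsetI) (erule LR, erule RL)
qed

section \<open>From functions on the cube to functions on subsets\<close>

lemma subgroup_symmetry_group: "subgroup (symmetry_group n f) (sym_group n)"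
proof -
  have comp: "x \<circ> \<sigma> \<in> cube n" if "x \<in> cube n" "\<sigma> permutes {1..n}" for x \<sigma>
    using that unfolding cube_def PiE_iff extensional_def
    by (auto simp: permutes_in_image permutes_not_in simp del: One_nat_def atLeastAtMost_iff)
  show ?thesis
  proof (rule group.subgroupI[OF sym_group_is_group])
    show "symmetry_group n f \<subseteq> carrier (sym_group n)"
      by (auto simp: symmetry_group_def)
    show "symmetry_group n f \<noteq> {}"
    proof -
      have "id \<in> symmetry_group n f"
        by (simp add: symmetry_group_def sym_group_carrier permutes_id)
      then show ?thesis by blast
    qed
    fix \<sigma> assume \<sigma>: "\<sigma> \<in> symmetry_group n f"
    then have p: "\<sigma> permutes {1..n}" by (simp add: symmetry_group_def sym_group_carrier)
    have "f (x \<circ> inv_into UNIV \<sigma>) = f x" if "x \<in> cube n" for x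
    proof -
      have "x \<circ> inv_into UNIV \<sigma> \<in> cube n"
        using comp that permutes_inv[OF p] by blast
      then have "f ((x \<circ> inv_into UNIV \<sigma>) \<circ> \<sigma>) = f (x \<circ> inv_into UNIV \<sigma>)"
        using \<sigma> by (simp add: symmetry_group_def)
      then show ?thesis
        by (simp add: o_assoc[symmetric] permutes_inv_o[OF p])
    qed
    moreover have "inv\<^bsub>sym_group n\<^esub> \<sigma> = inv_into UNIV \<sigma>"
      using p by (simp add: sym_group_inv_equality sym_group_carrier)
    ultimately show "inv\<^bsub>sym_group n\<^esub> \<sigma> \<in> symmetry_group n f"
      using permutes_inv[OF p] by (simp add: symmetry_group_def sym_group_carrier)
    fix \<tau> assume \<tau>: "\<tau> \<in> symmetry_group n f"
    have "f (x \<circ> (\<sigma> \<circ> \<tau>)) = f x" if "x \<in> cube n" for x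
      using \<sigma> \<tau> comp[OF that p] that by (simp add: symmetry_group_def o_assoc)
    then show "\<sigma> \<otimes>\<^bsub>sym_group n\<^esub> \<tau> \<in> symmetry_group n f"
      using \<sigma> \<tau> by (simp add: symmetry_group_def sym_group_carrier sym_group_mult permutes_compose)
  qed
qed

text \<open>Composing an indicator with \<open>\<sigma>\<close> gives the indicator of the preimage.
  Since \<open>\<sigma>\<close> permutes the subsets, quantifying over images of sets turns
  preimages into images.\<close>

lemma symmetry_group_eq_set_symmetries:
  "symmetry_group n f =
    set_symmetries {1..n} (\<lambda>S. f (restrict (indicator S) {1..n}))" (is "_ = set_symmetries _ ?\<phi>")
proof -
  let ?\<chi> = "\<lambda>S::nat set. restrict (indicator S) {1..n} :: nat \<Rightarrow> nat"
  have cube: "cube n = ?\<chi> ` Pow {1..n}"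
  proof (intro equalityI subsetI)
    fix x assume "x \<in> cube n"
    then have "x = ?\<chi> {i\<in>{1..n}. x i = 1}"
      by (fastforce simp: cube_def PiE_iff extensional_def fun_eq_iff indicator_def)
    then show "x \<in> ?\<chi> ` Pow {1..n}" by blast
  qed (auto simp: cube_def indicator_def)
  have comp: "?\<chi> (\<sigma> ` S) \<circ> \<sigma> = ?\<chi> S" if "\<sigma> permutes {1..n}" for \<sigma> S
    using permutes_in_image[OF that] inj_image_mem_iff[OF permutes_inj[OF that]] permutes_not_in[OF that]
    by (auto simp: fun_eq_iff indicator_def restrict_def)
  have "(\<forall>x\<in>cube n. f (x \<circ> \<sigma>) = f x) \<longleftrightarrow> (\<forall>S\<subseteq>{1..n}. ?\<phi> (\<sigma> ` S) = ?\<phi> S)"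
    if \<sigma>: "\<sigma> permutes {1..n}" for \<sigma>
  proof -
    have "(\<forall>x\<in>cube n. f (x \<circ> \<sigma>) = f x) \<longleftrightarrow>
      (\<forall>S\<in>image \<sigma> ` Pow {1..n}. f (?\<chi> S \<circ> \<sigma>) = f (?\<chi> S))"
      unfolding cube image_Pow_surj[OF permutes_image[OF \<sigma>]] by (simp only: ball_simps)
    also have "\<dots> \<longleftrightarrow> (\<forall>S\<in>Pow {1..n}. f (?\<chi> (\<sigma> ` S) \<circ> \<sigma>) = f (?\<chi> (\<sigma> ` S)))"
      by (simp only: ball_simps)
    finally show ?thesis
      unfolding comp[OF \<sigma>] by auto
  qed
  then show ?thesis
    by (auto simp: symmetry_group_def set_symmetries_def sym_group_carrier)
qed

lemma representable_iff_set_symmetries: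
  "representable k n G \<longleftrightarrow>
    2 \<le> k \<and> (\<exists>\<phi>. (\<forall>S\<subseteq>{1..n}. \<phi> S < k) \<and> G = set_symmetries {1..n} \<phi>)"
proof
  assume "representable k n G"
  then obtain f where f: "valued_boolean_function k n f" "G = symmetry_group n f"
    by (auto simp: representable_def)
  have "restrict (indicator S) {1..n} \<in> cube n" for S
    by (auto simp: cube_def indicator_def)
  then have "\<forall>S\<subseteq>{1..n}. f (restrict (indicator S) {1..n}) < k"
    using f(1) by (auto simp: valued_boolean_function_def Pi_iff simp del: One_nat_def)
  then show "2 \<le> k \<and> (\<exists>\<phi>. (\<forall>S\<subseteq>{1..n}. \<phi> S < k) \<and> G = set_symmetries {1..n} \<phi>)"
    using f unfolding symmetry_group_eq_set_symmetries valued_boolean_function_def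
    by (intro conjI exI[of _ "\<lambda>S. f (restrict (indicator S) {1..n})"]) simp_all
next
  assume "2 \<le> k \<and> (\<exists>\<phi>. (\<forall>S\<subseteq>{1..n}. \<phi> S < k) \<and> G = set_symmetries {1..n} \<phi>)"
  then obtain \<phi> where \<phi>: "2 \<le> k" "\<And>S. S \<subseteq> {1..n} \<Longrightarrow> \<phi> S < k" "G = set_symmetries {1..n} \<phi>"
    by blast
  \<comment> \<open>This inverts the indicator encoding. Any argument yields a subset of
    \<open>{1..n}\<close>, so the bound by \<open>k\<close> holds even off the cube.\<close>
  define f where "f = (\<lambda>x::nat \<Rightarrow> nat. \<phi> {i\<in>{1..n}. x i = 1})"
  have "{i\<in>{1..n}. restrict (indicator S) {1..n} i = (1::nat)} = S" if "S \<subseteq> {1..n}" for S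
    using that by (auto simp: indicator_def split: if_splits)
  then have eq: "f (restrict (indicator S) {1..n}) = \<phi> S" if "S \<subseteq> {1..n}" for S
    using that by (simp add: f_def)
  have "G = symmetry_group n f"
    unfolding symmetry_group_eq_set_symmetries \<phi>(3) set_symmetries_def
    using eq permutes_image by (metis (no_types, lifting) image_mono)
  moreover have "f x < k" for x
    unfolding f_def by (rule \<phi>(2)) auto
  then have "valued_boolean_function k n f"
    using \<phi>(1) by (simp add: valued_boolean_function_def)
  ultimately show "representable k n G"
    using subgroup_symmetry_group by (auto simp: representable_def)
qed

section \<open>Permutations acting separately on two blocks\<close>

lemma sum_perm_image:
  "S \<subseteq> {1..m} \<Longrightarrow> sum_perm m n \<sigma> \<tau> ` S = \<sigma> ` S"
  "T \<subseteq> {1..n} \<Longrightarrow> sum_perm m n \<sigma> \<tau> ` (+) m ` T = (+) m ` \<tau> ` T"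
proof -
  show "sum_perm m n \<sigma> \<tau> ` S = \<sigma> ` S" if "S \<subseteq> {1..m}"
    using that by (intro image_cong) (auto simp: sum_perm_def)
  show "sum_perm m n \<sigma> \<tau> ` (+) m ` T = (+) m ` \<tau> ` T" if "T \<subseteq> {1..n}"
    unfolding image_image using that by (intro image_cong) (auto simp: sum_perm_def)
qed

lemma block_cases:
  fixes i m n :: nat
  obtains "i \<in> {1..m}" | j where "j \<in> {1..n}" "i = m + j" | "i \<notin> {1..m} \<union> {m+1..m+n}"
proof (cases "i \<in> {m+1..m+n}")
  case True
  then have "i - m \<in> {1..n}" "i = m + (i - m)" by auto
  then show thesis by (rule that(2))
next
  case False
  then show thesis using that(1,3) by (cases "i \<in> {1..m}") auto
qed

text \<open>The inner map keeps each block, so the outer one acts there by the matching component.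
  This makes the sum of the inverses an inverse of the sum.\<close>

lemma sum_perm_comp:
  assumes "\<sigma>' permutes {1..m}" "\<tau>' permutes {1..n}"
  shows "sum_perm m n \<sigma> \<tau> \<circ> sum_perm m n \<sigma>' \<tau>' = sum_perm m n (\<sigma> \<circ> \<sigma>') (\<tau> \<circ> \<tau>')"
proof
  fix i
  consider "i \<in> {1..m}" | j where "j \<in> {1..n}" "i = m + j" | "i \<notin> {1..m} \<union> {m+1..m+n}"
    by (rule block_cases)
  then show "(sum_perm m n \<sigma> \<tau> \<circ> sum_perm m n \<sigma>' \<tau>') i = sum_perm m n (\<sigma> \<circ> \<sigma>') (\<tau> \<circ> \<tau>') i"
  proof cases
    case 1
    then have "\<sigma>' i \<in> {1..m}" using assms by (simp only: permutes_in_image)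
    then show ?thesis using 1 by (simp add: sum_perm_def)
  next
    case 2
    then have "\<tau>' j \<in> {1..n}" using assms by (simp only: permutes_in_image)
    then show ?thesis using 2 by (auto simp: sum_perm_def)
  next
    case 3
    then have "i \<notin> {1..m}" "i \<notin> {m+1..m+n}" by blast+
    then show ?thesis by (simp add: sum_perm_def del: atLeastAtMost_iff)
  qed
qed

lemma sum_perm_permutes:
  assumes "\<sigma> permutes {1..m}" "\<tau> permutes {1..n}"
  shows "sum_perm m n \<sigma> \<tau> permutes {1..m} \<union> (+) m ` {1..n}"
  unfolding permutes_def
proof
  have id: "sum_perm m n id id = id"
    by (auto simp: sum_perm_def fun_eq_iff)
  have "bij (sum_perm m n \<sigma> \<tau>)"
    using assms
    by (intro o_bij[of "sum_perm m n (inv_into UNIV \<sigma>) (inv_into UNIV \<tau>)"])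
      (simp_all add: sum_perm_comp permutes_inv permutes_inv_o id)
  then show "\<forall>j. \<exists>!i. sum_perm m n \<sigma> \<tau> i = j"
    by (simp add: bij_iff)
qed (auto simp: sum_perm_def image_add_atLeastAtMost)

lemma sum_perm_cases:
  assumes \<rho>: "\<rho> permutes {1..m} \<union> (+) m ` {1..n}" and A: "\<rho> ` {1..m} = {1..m}"
  obtains \<sigma> \<tau> where "\<sigma> permutes {1..m}" "\<tau> permutes {1..n}" "\<rho> = sum_perm m n \<sigma> \<tau>"
proof
  define \<sigma> where "\<sigma> = (\<lambda>i. if i \<in> {1..m} then \<rho> i else i)"
  \<comment> \<open>The restriction to the second block, conjugated by the shift. Subtraction does
    not truncate for \<open>i\<close> in \<open>{1..n}\<close>, as \<open>\<rho>\<close> maps the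
    second block to itself.\<close>
  define \<tau> where "\<tau> = (\<lambda>i. if i \<in> {1..n} then \<rho> (m + i) - m else i)"
  let ?B = "(+) m ` {1..n}"
  have inj: "inj \<rho>" by (rule permutes_inj[OF \<rho>])
  have "{1..m} \<inter> ?B = {}" by auto
  moreover have "\<rho> ` ({1..m} \<union> ?B - {1..m}) = {1..m} \<union> ?B - {1..m}"
    by (simp only: image_set_diff[OF inj] permutes_image[OF \<rho>] A)
  ultimately have B: "\<rho> ` ?B = ?B"
    by (simp add: Un_Diff Diff_triv Int_commute)
  have "bij_betw \<rho> {1..m} {1..m}"
    using A inj by (auto intro!: bij_betw_imageI inj_on_subset[OF inj])
  then have "bij_betw \<sigma> {1..m} {1..m}"
    by (rule bij_betw_cong[THEN iffD1, rotated]) (simp add: \<sigma>_def)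
  then show "\<sigma> permutes {1..m}"
    by (rule bij_imp_permutes) (auto simp: \<sigma>_def)
  have "bij_betw ((\<lambda>i. i - m) \<circ> (\<rho> \<circ> (+) m)) {1..n} {1..n}"
  proof (intro bij_betw_trans)
    show "bij_betw ((+) m) {1..n} ?B"
      by (simp add: bij_betw_imageI)
    show "bij_betw \<rho> ?B ?B"
      using B inj by (intro bij_betw_imageI inj_on_subset[OF inj]) auto
    show "bij_betw (\<lambda>i. i - m) ?B {1..n}"
      by (rule bij_betw_byWitness[of _ "(+) m"]) auto
  qed
  then have "bij_betw \<tau> {1..n} {1..n}"
    by (rule bij_betw_cong[THEN iffD1, rotated]) (simp add: \<tau>_def)
  then show "\<tau> permutes {1..n}"
    by (rule bij_imp_permutes) (auto simp: \<tau>_def)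
  show "\<rho> = sum_perm m n \<sigma> \<tau>"
  proof
    fix i
    consider "i \<in> {1..m}" | j where "j \<in> {1..n}" "i = m + j" | "i \<notin> {1..m} \<union> {m+1..m+n}"
      by (rule block_cases)
    then show "\<rho> i = sum_perm m n \<sigma> \<tau> i"
    proof cases
      case 2
      then have "\<rho> i \<in> ?B" using B by blast
      then show ?thesis using 2 by (auto simp: sum_perm_def \<tau>_def)
    next
      case 3
      then have "i \<notin> {1..m}" "i \<notin> {m+1..m+n}" "i \<notin> {1..m} \<union> ?B" by auto
      then show ?thesis using permutes_not_in[OF \<rho>, of i]
        by (simp add: sum_perm_def del: atLeastAtMost_iff)
    next
      case 1
      then show ?thesis by (simp add: sum_perm_def \<sigma>_def)
    qed
  qed
qed

section \<open>Gluing over a block and a shifted block\<close>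

theorem theorem2:
  fixes m n k :: nat and G H :: "(nat \<Rightarrow> nat) set"
  assumes "2 \<le> n" and "2 \<le> m" and "2 \<le> k"
    and "subgroup G (sym_group m)" and "subgroup H (sym_group n)"
    and "representable k m G" and "representable k n H"
  shows "\<forall>r::nat. k \<le> r\<^sup>2 \<longrightarrow> representable r (n + m) (direct_sum m n G H)"
proof (intro allI impI)
  fix r :: nat assume k: "k \<le> r\<^sup>2"
  have r: "2 \<le> r"
  proof (rule ccontr)
    assume "\<not> 2 \<le> r"
    then have "r = 0 \<or> r = 1" by auto
    then show False using k assms(3) by auto
  qed
  obtain \<phi> where \<phi>: "\<And>S. S \<subseteq> {1..m} \<Longrightarrow> \<phi> S < k" "G = set_symmetries {1..m} \<phi>"
    using assms(6) by (auto simp: representable_iff_set_symmetries)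
  obtain \<psi> where \<psi>: "\<And>S. S \<subseteq> {1..n} \<Longrightarrow> \<psi> S < k" "H = set_symmetries {1..n} \<psi>"
    using assms(7) by (auto simp: representable_iff_set_symmetries)
  obtain a b where ab: "\<forall>S\<subseteq>{1..m}. a S < r \<and> b S < r" "pair_connected {1..m} a"
    "G = set_symmetries {1..m} (\<lambda>S. (a S, b S))"
    by (rule digits_pair_connected[of "{1..m}" \<phi> k r, OF \<phi>(1) k r, folded \<phi>(2)])
  obtain c d where cd: "\<forall>S\<subseteq>{1..n}. c S < r \<and> d S < r" "pair_connected {1..n} c"
    "H = set_symmetries {1..n} (\<lambda>S. (c S, d S))"
    by (rule digits_pair_connected[of "{1..n}" \<psi> k r, OF \<psi>(1) k r, folded \<psi>(2)])
  let ?A = "{1..m}" and ?B = "(+) m ` {1..n}"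
  \<comment> \<open>The digits for \<open>H\<close> are carried to the second block; the preimage
    undoes the shift.\<close>
  define c' d' where "c' T = c ((+) m -` T)" and "d' T = d ((+) m -` T)" for T
  have c'd': "c' ((+) m ` T) = c T" "d' ((+) m ` T) = d T" for T
    by (simp_all add: c'_def d'_def inj_vimage_image_eq)
  have subB: "(\<forall>S\<subseteq>?B. P S) \<longleftrightarrow> (\<forall>T\<subseteq>{1..n}. P ((+) m ` T))" for P
    by (metis image_mono subset_imageE)
  define F where "F = glue ?A ?B a b c' d'"
  have conn: "pair_connected ?B c'"
    unfolding pair_connected_def
  proof (intro allI impI)
    fix S assume S: "S \<noteq> {} \<and> S \<subset> ?B"
    then obtain T where T: "T \<subset> {1..n}" "S = (+) m ` T"
      by (metis psubset_imp_subset subset_imageE psubsetE psubsetI)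
    then have "T \<noteq> {}"
      using S by auto
    then obtain x y where "x \<in> T" "y \<in> {1..n} - T" "c {x, y} \<noteq> 0"
      by (rule pair_connectedE[OF cd(2) _ T(1)])
    then have "m + x \<in> S" "m + y \<in> ?B - S" "c' {m + x, m + y} \<noteq> 0"
      using T c'd'(1)[of "{x, y}"] by auto
    then show "\<exists>x\<in>S. \<exists>y\<in>?B - S. c' {x, y} \<noteq> 0" by blast
  qed
  have blocks: "finite ?A" "finite ?B" "?A \<inter> ?B = {}" "2 \<le> card ?A" "2 \<le> card ?B"
    using assms(1,2) by (auto simp: card_image)
  have sym: "set_symmetries (?A \<union> ?B) F =
    {\<rho>. \<rho> permutes ?A \<union> ?B \<and> \<rho> ` ?A = ?A \<and>
      (\<forall>S\<subseteq>?A. a (\<rho> ` S) = a S \<and> b (\<rho> ` S) = b S) \<and>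
      (\<forall>T\<subseteq>{1..n}. c' (\<rho> ` (+) m ` T) = c T \<and> d' (\<rho> ` (+) m ` T) = d T)}"
    unfolding F_def set_symmetries_glue[OF blocks ab(2) conn] subB c'd' ..
  \<comment> \<open>\<open>sum_perm\<close> acts on subsets of each block through one component, so
    the conditions on \<open>a\<close>, \<open>b\<close> concern only \<open>\<sigma>\<close> and
    those on \<open>c'\<close>, \<open>d'\<close> only \<open>\<tau>\<close>.\<close>
  have mem: "sum_perm m n \<sigma> \<tau> \<in> set_symmetries (?A \<union> ?B) F \<longleftrightarrow> \<sigma> \<in> G \<and> \<tau> \<in> H"
    if "\<sigma> permutes {1..m}" "\<tau> permutes {1..n}" for \<sigma> \<tau>
    using that sum_perm_permutes[OF that]
    unfolding sym unfolding ab(3) cd(3) set_symmetries_def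
    by (simp add: sum_perm_image c'd' permutes_image del: One_nat_def cong: conj_cong)
  have "direct_sum m n G H = set_symmetries (?A \<union> ?B) F"
  proof (intro equalityI subsetI)
    fix \<rho> assume "\<rho> \<in> direct_sum m n G H"
    then obtain \<sigma> \<tau> where "\<rho> = sum_perm m n \<sigma> \<tau>" "\<sigma> \<in> G" "\<tau> \<in> H"
      by (auto simp: direct_sum_def)
    then show "\<rho> \<in> set_symmetries (?A \<union> ?B) F"
      using mem[of \<sigma> \<tau>] \<phi>(2) \<psi>(2) by (simp add: set_symmetries_def)
  next
    fix \<rho> assume \<rho>: "\<rho> \<in> set_symmetries (?A \<union> ?B) F"
    then have "\<rho> permutes ?A \<union> ?B" "\<rho> ` ?A = ?A"
      unfolding sym by simp_all
    then obtain \<sigma> \<tau> where "\<sigma> permutes {1..m}" "\<tau> permutes {1..n}" "\<rho> = sum_perm m n \<sigma> \<tau>"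
      by (rule sum_perm_cases)
    then show "\<rho> \<in> direct_sum m n G H"
      using mem \<rho> by (auto simp: direct_sum_def)
  qed
  moreover have "?A \<union> ?B = {1..n + m}"
    by (auto simp: image_add_atLeastAtMost)
  moreover have "\<forall>S\<subseteq>?B. c' S < r \<and> d' S < r"
    unfolding subB c'd' by (rule cd(1))
  \<comment> \<open>This holds for every \<open>S\<close>, since \<open>glue\<close> reads only its
    intersections with the blocks.\<close>
  then have "F S < r" for S
    unfolding F_def using r ab(1) by (intro glue_less) simp_all
  ultimately show "representable r (n + m) (direct_sum m n G H)"
    unfolding representable_iff_set_symmetries using r by (intro conjI exI[of _ F]) simp_all
qed

end
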